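(* For every integer $k\ge 0$, the following six identities hold: \begin{align*} \frac{F_{6k+2}-1}{2}F_{6k+1} + \frac{F_{6k-1}-1}{2}F_{6k+3} &= \frac{(F_{6k+1}-1)(F_{6k+3}-1)}{2},\\ \frac{F_{6k+2}-1}{2}F_{6k+2}+\frac{F_{6k+1}-1}{2}F_{6k+4} &= \frac{(F_{6k+2}-1)(F_{6k+4}-1)}{2},\\ \frac{F_{6k+4}-1}{2}F_{6k+3} + \frac{F_{6k+1}-1}{2}F_{6k+5}&= \frac{(F_{6k+3}-1)(F_{6k+5}-1)}{2},\\ 1+ \frac{F_{6k+5}-1}{2}F_{6k+4} + \frac{F_{6k+2}-1}{2}F_{6k+6} &= \frac{(F_{6k+4}-1)(F_{6k+6}-1)}{2},\\ 1+ \frac{F_{6k+5}-1}{2}F_{6k+5} + \frac{F_{6k+4}-1}{2}F_{6k+7}&= \frac{(F_{6k+5}-1)(F_{6k+7}-1)}{2},\\ 1+\frac{F_{6k+1}-1}{2}F_{6k} + \frac{F_{6k-2}-1}{2}F_{6k+2}&= \frac{(F_{6k}-1)(F_{6k+2}-1)}{2}. \end{align*}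
   Context: $F_n$ denotes the $n$-th Fibonacci number, indexed by $F_1=1$, $F_2=1$, and the recurrence $F_{n+2}=F_{n+1}+F_n$, extended to all integers $n\in\mathbb{Z}$ by the same recurrence (so $F_0=0$, $F_{-1}=1$, $F_{-2}=-1$, which occur when $k=0$). The divisions by $2$ are ordinary divisions of rational numbers. *)

theory Defs
  imports Complex_Main "HOL-Number_Theory.Fib"
begin

text \<open>The library function \<open>fib\<close> has \<open>fib 0 = 0\<close> and \<open>fib 1 = 1\<close>. It is extended to
  negative indices by the Fibonacci recurrence read backwards, \<open>F(n) = F(n+2) - F(n+1)\<close>.\<close>

function fib_int :: "int \<Rightarrow> int" where
  "fib_int n = (if 0 \<le> n then int (fib (nat n)) else fib_int (n + 2) - fib_int (n + 1))"
  by pat_completeness auto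
termination
  by (relation "measure (\<lambda>n. nat (1 - n))") auto

declare fib_int.simps [simp del]

lemma fib_int_1: "fib_int 1 = 1"
  and fib_int_2: "fib_int 2 = 1"
  by (simp_all add: fib_int.simps numeral_2_eq_2)

lemma fib_int_rec: "fib_int (n + 2) = fib_int (n + 1) + fib_int n"
proof (cases "0 \<le> n")
  case True
  then have "nat (n + 2) = Suc (Suc (nat n))" "nat (n + 1) = Suc (nat n)" by auto
  with True show ?thesis by (simp add: fib_int.simps)
next
  case False
  then show ?thesis by (simp add: fib_int.simps [of n])
qed

lemma fib_int_negative: "fib_int (-1) = 1" "fib_int (-2) = -1"
  using fib_int_rec [of "-1"] fib_int_rec [of "-2"]
  by (simp_all add: fib_int.simps [of 0] fib_int.simps [of 1])

abbreviation F :: "int \<Rightarrow> rat" where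
  "F n \<equiv> of_int (fib_int n)"

end

theory Submission
  imports Defs
begin

text \<open>
  Writing \<open>a = F (6k)\<close> and \<open>b = F (6k + 1)\<close>, every term is a polynomial in \<open>a\<close> and \<open>b\<close>. The linear
  terms of the two sides of each identity agree, and what remains is Cassini's identity for an
  even index, \<open>b\<^sup>2 - a b - a\<^sup>2 = 1\<close>.
\<close>

text \<open>For \<open>n \<ge> 0\<close>, \<open>fib_int\<close> is the library \<open>fib\<close>.
  Cassini's sign \<open>(-1)^n\<close> is 1 for even \<open>n\<close>, and expanding
  \<open>fib (n + 2)\<close> leaves a relation between two neighbours.\<close>

lemma fib_int_Cassini_even:
  assumes "0 \<le> n" "even n"
  shows "fib_int (n + 1) * fib_int (n + 1) = fib_int n * fib_int (n + 1) + fib_int n * fib_int n + 1"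
proof -
  have "fib_int n = int (fib (nat n))" "fib_int (n + 1) = int (fib (Suc (nat n)))"
    using assms by (simp_all add: fib_int.simps nat_add_distrib)
  moreover have "even (nat n)"
    using assms by (simp add: even_nat_iff)
  ultimately show ?thesis
    using fib_Cassini_int [of "nat n"] by (simp add: power2_eq_square algebra_simps)
qed

theorem theorem1p6:
  fixes k :: int
  assumes "k \<ge> 0"
  shows "((F (6*k+2) - 1) / 2 * F (6*k+1) + (F (6*k-1) - 1) / 2 * F (6*k+3)
           = (F (6*k+1) - 1) * (F (6*k+3) - 1) / 2) \<and>
       ((F (6*k+2) - 1) / 2 * F (6*k+2) + (F (6*k+1) - 1) / 2 * F (6*k+4)
           = (F (6*k+2) - 1) * (F (6*k+4) - 1) / 2) \<and>
       ((F (6*k+4) - 1) / 2 * F (6*k+3) + (F (6*k+1) - 1) / 2 * F (6*k+5)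
           = (F (6*k+3) - 1) * (F (6*k+5) - 1) / 2) \<and>
       (1 + (F (6*k+5) - 1) / 2 * F (6*k+4) + (F (6*k+2) - 1) / 2 * F (6*k+6)
           = (F (6*k+4) - 1) * (F (6*k+6) - 1) / 2) \<and>
       (1 + (F (6*k+5) - 1) / 2 * F (6*k+5) + (F (6*k+4) - 1) / 2 * F (6*k+7)
           = (F (6*k+5) - 1) * (F (6*k+7) - 1) / 2) \<and>
       (1 + (F (6*k+1) - 1) / 2 * F (6*k) + (F (6*k-2) - 1) / 2 * F (6*k+2)
           = (F (6*k) - 1) * (F (6*k+2) - 1) / 2)"
proof -
  define a b where "a = F (6*k)" and "b = F (6*k+1)"
  \<comment> \<open>The index equations are premises, so offsets such as \<open>6*k-1\<close> are
    matched by arithmetic, not syntactically.\<close>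
  have rec: "F p = F m + F n" if "p = n + 2" "m = n + 1" for p m n
    using that by (simp add: fib_int_rec)
  have "F (6*k+2) = F (6*k+1) + F (6*k)" "F (6*k+3) = F (6*k+2) + F (6*k+1)"
    "F (6*k+4) = F (6*k+3) + F (6*k+2)" "F (6*k+5) = F (6*k+4) + F (6*k+3)"
    "F (6*k+6) = F (6*k+5) + F (6*k+4)" "F (6*k+7) = F (6*k+6) + F (6*k+5)"
    "F (6*k+1) = F (6*k) + F (6*k-1)" "F (6*k) = F (6*k-1) + F (6*k-2)"
    by (rule rec; simp)+
  then have F: "F (6*k) = a" "F (6*k+1) = b" "F (6*k+2) = a + b" "F (6*k+3) = a + 2 * b"
    "F (6*k+4) = 2 * a + 3 * b" "F (6*k+5) = 3 * a + 5 * b" "F (6*k+6) = 5 * a + 8 * b"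
    "F (6*k+7) = 8 * a + 13 * b" "F (6*k-1) = b - a" "F (6*k-2) = 2 * a - b"
    unfolding a_def b_def by linarith+
  have "b * b = a * b + a * a + 1"
    unfolding a_def b_def of_int_mult [symmetric]
    using assms by (subst fib_int_Cassini_even) simp_all
  \<comment> \<open>Twice the left side minus twice the right is
    \<open>b * b - a * b - a * a - 1\<close> in the first three identities and its negative in the
    last three, where the added 1 supplies the constant needed.\<close>
  then show ?thesis
    unfolding F by (simp add: field_simps)
qed

end
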